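(* Let $\epsilon>0$ and assume that $g$ is $C^2$ on a neighborhood of $\widehat X$. If $d_X(g)=0$, the adaptive lower-model method (described in the context) terminates after solving the first lower-model subproblem. If $d_X(g)>0$, it terminates after at most $$N_\epsilon=\mathcal{P}\Bigl(P_{V_X(g)}X,\ \sqrt{\tfrac{2\epsilon}{L_X(g)}}\Bigr)\ \le\ \Bigl(1+D_X(g)\sqrt{\tfrac{2L_X(g)}{\epsilon}}\Bigr)^{d_X(g)}$$ globally solved lower-model subproblems. Consequently, the outer iteration count (the number of globally solved lower-model subproblems) is $O(\epsilon^{-d_X(g)/2})$ as $\epsilon\downarrow0$.
   Context: $X\subset\mathbb{R}^n$ is nonempty and compact, $\widehat X=\operatorname{conv}X$, and $g,h$ are finite convex functions on an open convex neighborhood of $\widehat X$. Adaptive lower-model method with tolerance $\epsilon>0$, for $\min_{x\in X}\{g(x)-h(x)\}$. For a support point $x_i\in X$ and chosen $v_i\in\partial g(x_i)$ (convex subdifferential) put $\ell_i(z)=g(x_i)+\langle v_i,z-x_i\rangle$. (1) Choose $x_0\in X$ and $v_0\in\partial g(x_0)$; set $g_0=\ell_0$. (2) For $k=1,2,\dots$, compute a global minimizer $x_k\in\operatorname{argmin}_{x\in X}\{g_{k-1}(x)-h(x)\}$ (the $k$-th lower-model subproblem, solved exactly; any choice of minimizer is allowed). (3) If $g(x_k)-g_{k-1}(x_k)\le\epsilon$, terminate and return $x_k$. Otherwise choose any $v_k\in\partial g(x_k)$, set $g_k=\max\{g_{k-1},\ell_k\}$, and continue with the next $k$. The initialization $x_0$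 is not counted as a solved subproblem: if $K$ is the first terminating index, the number of globally solved lower-model subproblems is $K$. Notation: $V_X(g)=\operatorname{span}\bigl(\bigcup_{z\in\widehat X}\operatorname{range}\nabla^2g(z)\bigr)$; $d_X(g)=\dim V_X(g)$; $L_X(g)=\sup_{z\in\widehat X}\lambda_{\max}(\nabla^2g(z))$; $P_V$ is Euclidean orthogonal projection onto $V$; $D_X(g)=\operatorname{diam}(P_{V_X(g)}X)$. For a compact Euclidean set $S$ and $\rho>0$, $\mathcal{P}(S,\rho)$ is the supremal cardinality of a subset of $S$ whose distinct points are at distance more than $\rho$ from each other. *)

theory Defs
  imports "HOL-Analysis.Analysis" "HOL-Library.Landau_Symbols"
begin

section \<open>Convex subdifferential, gradient and Hessian\<close>

text \<open>The subdifferential of a function that is finite and convex on \<open>C\<close> (and considered only there).\<close>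

definition subdifferential :: "(real^'n) set \<Rightarrow> (real^'n \<Rightarrow> real) \<Rightarrow> real^'n \<Rightarrow> (real^'n) set" where
  "subdifferential C g x = {v. \<forall>y\<in>C. g x + v \<bullet> (y - x) \<le> g y}"

definition gradient :: "(real^'n \<Rightarrow> real) \<Rightarrow> real^'n \<Rightarrow> real^'n" where
  "gradient g x = (THE D. GDERIV g x :> D)"

definition hessian :: "(real^'n \<Rightarrow> real) \<Rightarrow> real^'n \<Rightarrow> real^'n^'n" where
  "hessian g x = jacobian (gradient g) (at x)"

text \<open>Meant for open \<open>U\<close>.\<close>

definition C2_on :: "(real^'n) set \<Rightarrow> (real^'n \<Rightarrow> real) \<Rightarrow> bool" where
  "C2_on U g \<longleftrightarrow>
     (\<forall>x\<in>U. g differentiable (at x) \<and> gradient g differentiable (at x)) \<and>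
     continuous_on U (hessian g)"

text \<open>Meant for symmetric matrices, whose real eigenvalues form a finite nonempty set.\<close>

definition lambda_max :: "real^'n^'n \<Rightarrow> real" where
  "lambda_max A = Max {l. \<exists>v. v \<noteq> 0 \<and> A *v v = l *\<^sub>R v}"

section \<open>The quantities attached to the curvature of \<open>g\<close> over the convex hull of \<open>X\<close>\<close>

definition orth_proj :: "(real^'n) set \<Rightarrow> real^'n \<Rightarrow> real^'n" where
  "orth_proj V x = (THE p. p \<in> V \<and> (\<forall>w\<in>V. orthogonal (x - p) w))"

definition V_X :: "(real^'n) set \<Rightarrow> (real^'n \<Rightarrow> real) \<Rightarrow> (real^'n) set" where
  "V_X X g = span (\<Union>z\<in>convex hull X. range (\<lambda>u. hessian g z *v u))"

definition d_X :: "(real^'n) set \<Rightarrow> (real^'n \<Rightarrow> real) \<Rightarrow> nat" where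
  "d_X X g = dim (V_X X g)"

definition L_X :: "(real^'n) set \<Rightarrow> (real^'n \<Rightarrow> real) \<Rightarrow> real" where
  "L_X X g = (SUP z\<in>convex hull X. lambda_max (hessian g z))"

definition D_X :: "(real^'n) set \<Rightarrow> (real^'n \<Rightarrow> real) \<Rightarrow> real" where
  "D_X X g = diameter (orth_proj (V_X X g) ` X)"

definition packing_number :: "(real^'n) set \<Rightarrow> real \<Rightarrow> enat" where
  "packing_number S \<rho> =
     (SUP A\<in>{A. A \<subseteq> S \<and> (\<forall>x\<in>A. \<forall>y\<in>A. x \<noteq> y \<longrightarrow> dist x y > \<rho>)}.
        if finite A then enat (card A) else \<infinity>)"

section \<open>The adaptive lower-model method\<close>

definition affine_minorant :: "(real^'n \<Rightarrow> real) \<Rightarrow> real^'n \<Rightarrow> real^'n \<Rightarrow> real^'n \<Rightarrow> real" where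
  "affine_minorant g x v z = g x + v \<bullet> (z - x)"

text \<open>The model \<open>g\<^sub>k\<close> built from support points \<open>x\<^sub>i\<close> and subgradients \<open>v\<^sub>i\<close>.\<close>

primrec lower_model ::
  "(real^'n \<Rightarrow> real) \<Rightarrow> (nat \<Rightarrow> real^'n) \<Rightarrow> (nat \<Rightarrow> real^'n) \<Rightarrow> nat \<Rightarrow> real^'n \<Rightarrow> real" where
  "lower_model g x v 0 = affine_minorant g (x 0) (v 0)"
| "lower_model g x v (Suc k) =
     (\<lambda>z. max (lower_model g x v k z) (affine_minorant g (x (Suc k)) (v (Suc k)) z))"

text \<open>The stopping test after the \<open>k\<close>-th subproblem, \<open>k \<ge> 1\<close>.\<close>

definition stops_at ::
  "(real^'n \<Rightarrow> real) \<Rightarrow> real \<Rightarrow> (nat \<Rightarrow> real^'n) \<Rightarrow> (nat \<Rightarrow> real^'n) \<Rightarrow> nat \<Rightarrow> bool" where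
  "stops_at g \<epsilon> x v k \<longleftrightarrow> g (x k) - lower_model g x v (k - 1) (x k) \<le> \<epsilon>"

text \<open>
  \<open>partial_run X C g h \<epsilon> x v K\<close>: with the choices \<open>x\<^sub>0, \<dots>, x\<^sub>K\<close> and \<open>v\<^sub>0, \<dots>, v\<^sub>K\<^sub>-\<^sub>1\<close> (only
  \<open>x\<^sub>0\<close>, \<open>v\<^sub>0\<close> if \<open>K = 0\<close>) the method has solved exactly \<open>K\<close> subproblems so far, the stopping test
  having failed after each of the subproblems \<open>1, \<dots>, K - 1\<close>; the test after subproblem \<open>K\<close> is
  still to be made. All other values of \<open>x\<close> and \<open>v\<close> are irrelevant.
\<close>

definition partial_run ::
  "(real^'n) set \<Rightarrow> (real^'n) set \<Rightarrow> (real^'n \<Rightarrow> real) \<Rightarrow> (real^'n \<Rightarrow> real) \<Rightarrow> real \<Rightarrow>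
   (nat \<Rightarrow> real^'n) \<Rightarrow> (nat \<Rightarrow> real^'n) \<Rightarrow> nat \<Rightarrow> bool" where
  "partial_run X C g h \<epsilon> x v K \<longleftrightarrow>
     x 0 \<in> X \<and> v 0 \<in> subdifferential C g (x 0) \<and>
     (\<forall>k\<in>{1..K}. is_arg_min (\<lambda>z. lower_model g x v (k - 1) z - h z) (\<lambda>z. z \<in> X) (x k)) \<and>
     (\<forall>k\<in>{1..<K}. \<not> stops_at g \<epsilon> x v k \<and> v k \<in> subdifferential C g (x k))"

text \<open>A complete run; \<open>K\<close> is the first terminating index.\<close>

definition terminating_run ::
  "(real^'n) set \<Rightarrow> (real^'n) set \<Rightarrow> (real^'n \<Rightarrow> real) \<Rightarrow> (real^'n \<Rightarrow> real) \<Rightarrow> real \<Rightarrow>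
   (nat \<Rightarrow> real^'n) \<Rightarrow> (nat \<Rightarrow> real^'n) \<Rightarrow> nat \<Rightarrow> bool" where
  "terminating_run X C g h \<epsilon> x v K \<longleftrightarrow>
     K \<ge> 1 \<and> partial_run X C g h \<epsilon> x v K \<and> stops_at g \<epsilon> x v K"

text \<open>
  Whatever choices are made, no more than \<open>N\<close> subproblems are ever solved, and the method never
  gets stuck: every partial run continues to a complete one (which, being itself a partial run,
  also solves at most \<open>N\<close> subproblems).
\<close>

definition terminates_within ::
  "(real^'n) set \<Rightarrow> (real^'n) set \<Rightarrow> (real^'n \<Rightarrow> real) \<Rightarrow> (real^'n \<Rightarrow> real) \<Rightarrow> real \<Rightarrow>
   enat \<Rightarrow> bool" where
  "terminates_within X C g h \<epsilon> N \<longleftrightarrow>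
     (\<forall>x v K. partial_run X C g h \<epsilon> x v K \<longrightarrow>
        enat K \<le> N \<and>
        (\<exists>x' v' K'. K \<le> K' \<and> (\<forall>i\<le>K. x' i = x i) \<and> (\<forall>i\<le>K - 1. v' i = v i) \<and>
           terminating_run X C g h \<epsilon> x' v' K'))"

end

theory Submission
  imports Defs
begin

text \<open>
  As \<open>g\<close> is differentiable near the convex hull of \<open>X\<close>, every subgradient is the gradient. The Hessian
  \<open>H\<close> is symmetric with range in \<open>V = V_X X g\<close>, so \<open>u \<bullet> H u = P u \<bullet> H (P u) \<le> L |P u|\<^sup>2\<close> for the orthogonal
  projection \<open>P\<close> onto \<open>V\<close>, and by Taylor's formula the linearization of \<open>g\<close> at \<open>x\<close> errs at \<open>y\<close> by at
  most \<open>L |P (y - x)|\<^sup>2 / 2\<close>. If the test fails at \<open>x\<^sub>k\<close>, all earlier linearizations err there by more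
  than \<open>\<epsilon>\<close>, so \<open>P x\<^sub>k\<close> has distance more than \<open>sqrt (2 \<epsilon> / L)\<close> from all earlier \<open>P x\<^sub>i\<close>: the projected
  iterates form a packing. Comparing volumes of disjoint balls in \<open>V\<close> bounds its size.
\<close>

section \<open>Gradient and Hessian\<close>

text \<open>\<open>gradient\<close> is a definite description, so existence and uniqueness both have
  to be supplied. A linear functional is the inner product with the value of its adjoint at 1, and
  derivatives are unique.\<close>

lemma gradient_has_derivative:
  assumes "g differentiable (at x)"
  shows "(g has_derivative (\<lambda>h. gradient g x \<bullet> h)) (at x)"
proof -
  obtain f where f: "(g has_derivative f) (at x)"
    using assms by (auto simp: differentiable_def)
  then have "linear f"
    by (rule has_derivative_linear)
  then have "f h = h \<bullet> adjoint f 1" for h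
    using adjoint_works[of f h 1] by simp
  then obtain D where "f = (\<lambda>h. h \<bullet> D)" by blast
  with f have "GDERIV g x :> D"
    by (simp add: gderiv_def)
  moreover have "D = D'" if "GDERIV g x :> D" "GDERIV g x :> D'" for D D'
  proof -
    have "(\<lambda>h. h \<bullet> D) = (\<lambda>h. h \<bullet> D')"
      using that unfolding gderiv_def by (rule has_derivative_unique)
    then have "\<forall>h. h \<bullet> D = h \<bullet> D'"
      by (simp add: fun_eq_iff)
    then show ?thesis
      by (rule vector_eq_ldot[THEN iffD1])
  qed
  ultimately have "GDERIV g x :> gradient g x"
    unfolding gradient_def by (blast intro: theI)
  then show ?thesis
    by (simp add: gderiv_def inner_commute)
qed

lemma hessian_has_derivative:
  assumes "gradient g differentiable (at x)"
  shows "(gradient g has_derivative (\<lambda>h. hessian g x *v h)) (at x)"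
  using assms by (simp add: hessian_def jacobian_works)

lemma gradient_DERIV_segment:
  assumes "g differentiable (at (x + t *\<^sub>R u))"
  shows "((\<lambda>t. g (x + t *\<^sub>R u)) has_real_derivative gradient g (x + t *\<^sub>R u) \<bullet> u) (at t)"
proof -
  have "((\<lambda>t. x + t *\<^sub>R u) has_derivative (\<lambda>s. s *\<^sub>R u)) (at t)"
    by (auto intro!: derivative_eq_intros)
  from has_derivative_compose[OF this gradient_has_derivative[OF assms]]
  show ?thesis
    by (simp add: has_field_derivative_def mult.commute[of _ "gradient _ _ \<bullet> _"])
qed

lemma hessian_DERIV_segment:
  assumes "gradient g differentiable (at (x + t *\<^sub>R u))"
  shows "((\<lambda>t. gradient g (x + t *\<^sub>R u) \<bullet> w) has_real_derivative
           (hessian g (x + t *\<^sub>R u) *v u) \<bullet> w) (at t)"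
proof -
  have "((\<lambda>t. x + t *\<^sub>R u) has_derivative (\<lambda>s. s *\<^sub>R u)) (at t)"
    by (auto intro!: derivative_eq_intros)
  from has_derivative_inner_left[OF has_derivative_compose[OF this hessian_has_derivative[OF assms]], of w]
  show ?thesis
    by (simp add: has_field_derivative_def matrix_vector_mult_scaleR mult.commute[of _ "_ \<bullet> _"])
qed

text \<open>The quotient is symmetric in \<open>u\<close> and \<open>v\<close>, hence so is its limit: this is the symmetry of the Hessian.\<close>

lemma second_difference_tendsto:
  assumes "open U" "x \<in> U" "\<And>y. y \<in> U \<Longrightarrow> g differentiable (at y)"
    and "gradient g differentiable (at x)"
  shows "((\<lambda>t. (g (x + t *\<^sub>R u + t *\<^sub>R v) - g (x + t *\<^sub>R u) - g (x + t *\<^sub>R v) + g x) / t\<^sup>2)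
           \<longlongrightarrow> (hessian g x *v u) \<bullet> v) (at_right 0)"
proof (rule tendstoI)
  fix e :: real assume "e > 0"
  define H where "H w = hessian g x *v w" for w
  \<comment> \<open>The two remainder estimates below add up to
    \<open>t * (e / (2 * M)) * (M - 1)\<close>. The added 1 keeps \<open>M\<close> positive when
    \<open>v = 0\<close>, and the slack from \<open>M - 1\<close> to \<open>2 * M\<close> makes the
    final bound strict.\<close>
  define M where "M = norm v * (2 * norm v + norm u) + 1"
  have "M > 0" by (simp add: M_def add_nonneg_pos)
  obtain d1 where d1: "d1 > 0" "\<And>y. norm (y - x) < d1 \<Longrightarrow>
      norm (gradient g y - gradient g x - H (y - x)) \<le> e / (2 * M) * norm (y - x)"
    using hessian_has_derivative[OF assms(4)] \<open>e > 0\<close> \<open>M > 0\<close>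
    unfolding has_derivative_at_alt H_def by (metis divide_pos_pos mult_pos_pos zero_less_numeral)
  obtain d2 where d2: "d2 > 0" "ball x d2 \<subseteq> U"
    using assms by (meson openE)
  \<comment> \<open>For \<open>t < d\<close>, moving from \<open>x\<close> by at most
    \<open>t\<close> along each of \<open>u\<close> and \<open>v\<close> stays within both radii
    \<open>d1\<close> and \<open>d2\<close>; the 1 in the denominator covers
    \<open>u = v = 0\<close>.\<close>
  define d where "d = min d1 d2 / (norm u + norm v + 1)"
  have uv: "norm u + norm v + 1 > 0" by (simp add: add_nonneg_pos)
  have "d > 0" using d1 d2 uv by (simp add: d_def)
  have "dist ((g (x + t *\<^sub>R u + t *\<^sub>R v) - g (x + t *\<^sub>R u) - g (x + t *\<^sub>R v) + g x) / t\<^sup>2)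
             (H u \<bullet> v) < e" if t: "0 < t" "t < d" for t
  proof -
    have tb: "t * (norm u + norm v) < min d1 d2"
    proof -
      have "t * (norm u + norm v + 1) < min d1 d2"
        using t uv by (simp add: d_def pos_less_divide_eq)
      then show ?thesis using t by (simp add: algebra_simps)
    qed
    have near: "norm (a *\<^sub>R u + b *\<^sub>R v) \<le> t * (norm u + norm v)"
      if "0 \<le> a" "a \<le> t" "0 \<le> b" "b \<le> t" for a b
    proof -
      have "norm (a *\<^sub>R u + b *\<^sub>R v) \<le> a * norm u + b * norm v"
        using norm_triangle_ineq[of "a *\<^sub>R u" "b *\<^sub>R v"] that by simp
      also have "\<dots> \<le> t * norm u + t * norm v"
        using that by (intro add_mono mult_right_mono) auto
      finally show ?thesis by (simp add: algebra_simps)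
    qed
    have inU: "x + a *\<^sub>R u + b *\<^sub>R v \<in> U" if "0 \<le> a" "a \<le> t" "0 \<le> b" "b \<le> t" for a b
    proof -
      have "norm (a *\<^sub>R u + b *\<^sub>R v) < d2" using near[OF that] tb by linarith
      then have "x + a *\<^sub>R u + b *\<^sub>R v \<in> ball x d2"
        by (simp add: dist_norm algebra_simps) (metis add.commute norm_minus_cancel minus_add_distrib uminus_add_conv_diff)
      then show ?thesis using d2 by auto
    qed
    \<comment> \<open>The second difference is \<open>\<phi> t - \<phi> 0\<close>. The mean value
      theorem in direction \<open>v\<close> turns it into a difference of gradients, which
      differentiability of the gradient at \<open>x\<close> expands with remainder
      \<open>r\<close>.\<close>
    define \<phi> where "\<phi> s = g ((x + t *\<^sub>R u) + s *\<^sub>R v) - g (x + s *\<^sub>R v)" for s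
    define \<phi>' where "\<phi>' s = gradient g ((x + t *\<^sub>R u) + s *\<^sub>R v) \<bullet> v - gradient g (x + s *\<^sub>R v) \<bullet> v" for s
    have der: "(\<phi> has_real_derivative \<phi>' s) (at s)" if "0 \<le> s" "s \<le> t" for s
      unfolding \<phi>_def \<phi>'_def
      using inU[of t s] inU[of 0 s] that t
      by (intro DERIV_diff gradient_DERIV_segment assms(3)) auto
    obtain s where s: "0 < s" "s < t" "\<phi> t - \<phi> 0 = (t - 0) * \<phi>' s"
      using MVT2[of 0 t \<phi> \<phi>'] der t by blast
    define r where "r y = gradient g y - gradient g x - H (y - x)" for y
    have lin: "H (a + b) = H a + H b" "H (c *\<^sub>R a) = c *\<^sub>R H a" for a b c
      by (simp_all add: H_def matrix_vector_mult_scaleR matrix_vector_right_distrib)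
    have "\<phi>' s = (gradient g ((x + t *\<^sub>R u) + s *\<^sub>R v) - gradient g (x + s *\<^sub>R v)) \<bullet> v"
      by (simp add: \<phi>'_def inner_diff_left)
    also have "gradient g ((x + t *\<^sub>R u) + s *\<^sub>R v) - gradient g (x + s *\<^sub>R v)
       = t *\<^sub>R H u + (r (x + t *\<^sub>R u + s *\<^sub>R v) - r (x + s *\<^sub>R v))"
      by (simp add: r_def lin algebra_simps)
    finally have \<phi>'s: "\<phi>' s = t * (H u \<bullet> v) + (r (x + t *\<^sub>R u + s *\<^sub>R v) - r (x + s *\<^sub>R v)) \<bullet> v"
      by (simp add: inner_add_left)
    have rb: "norm (r (x + a *\<^sub>R u + b *\<^sub>R v)) \<le> e / (2 * M) * norm (a *\<^sub>R u + b *\<^sub>R v)"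
      if "0 \<le> a" "a \<le> t" "0 \<le> b" "b \<le> t" for a b
      using d1(2)[of "x + a *\<^sub>R u + b *\<^sub>R v"] near[OF that] tb
      by (simp add: r_def add.assoc)
    have n1: "norm (t *\<^sub>R u + s *\<^sub>R v) \<le> t * (norm u + norm v)"
      using s by (intro near) auto
    have n2: "norm (s *\<^sub>R v) \<le> t * norm v"
      using s t by (simp add: mult_right_mono)
    have "\<bar>\<phi>' s - t * (H u \<bullet> v)\<bar> \<le> norm (r (x + t *\<^sub>R u + s *\<^sub>R v) - r (x + s *\<^sub>R v)) * norm v"
      by (simp add: \<phi>'s Cauchy_Schwarz_ineq2)
    also have "\<dots> \<le> (norm (r (x + t *\<^sub>R u + s *\<^sub>R v)) + norm (r (x + s *\<^sub>R v))) * norm v"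
      by (intro mult_right_mono norm_triangle_ineq4) auto
    also have "\<dots> \<le> (e / (2 * M) * (t * (norm u + norm v)) + e / (2 * M) * (t * norm v)) * norm v"
    proof (intro mult_right_mono add_mono)
      have c: "0 \<le> e / (2 * M)" using \<open>e > 0\<close> \<open>M > 0\<close> by simp
      show "norm (r (x + t *\<^sub>R u + s *\<^sub>R v)) \<le> e / (2 * M) * (t * (norm u + norm v))"
        using rb[of t s] s mult_left_mono[OF n1 c] by linarith
      show "norm (r (x + s *\<^sub>R v)) \<le> e / (2 * M) * (t * norm v)"
        using rb[of 0 s] s mult_left_mono[OF n2 c] by simp
    qed auto
    also have "\<dots> = t * (e / (2 * M)) * (M - 1)"
    proof -
      have "M - 1 = norm v * (2 * norm v + norm u)" by (simp add: M_def)
      then show ?thesis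
        by (simp only:) (simp only: ring_distribs mult_2 mult_ac add_ac)
    qed
    also have "\<dots> < t * (e / (2 * M)) * (2 * M)"
      using t \<open>e > 0\<close> \<open>M > 0\<close> by (intro mult_strict_left_mono) auto
    also have "\<dots> = t * e" using \<open>M > 0\<close> by simp
    finally have *: "\<bar>\<phi>' s - t * (H u \<bullet> v)\<bar> < t * e" .
    have "g (x + t *\<^sub>R u + t *\<^sub>R v) - g (x + t *\<^sub>R u) - g (x + t *\<^sub>R v) + g x = t * \<phi>' s"
      using s(3) by (simp add: \<phi>_def)
    then have "(g (x + t *\<^sub>R u + t *\<^sub>R v) - g (x + t *\<^sub>R u) - g (x + t *\<^sub>R v) + g x) / t\<^sup>2 - H u \<bullet> v
        = (\<phi>' s - t * (H u \<bullet> v)) / t"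
      using t by (simp add: field_simps power2_eq_square)
    then show ?thesis
      using * t by (simp add: dist_real_def pos_divide_less_eq mult.commute)
  qed
  then show "\<forall>\<^sub>F t in at_right 0. dist ((g (x + t *\<^sub>R u + t *\<^sub>R v) - g (x + t *\<^sub>R u) - g (x + t *\<^sub>R v) + g x) / t\<^sup>2)
             ((hessian g x *v u) \<bullet> v) < e"
    using \<open>d > 0\<close> unfolding eventually_at_right_field H_def by blast
qed

lemma hessian_symmetric:
  assumes "open U" "x \<in> U" "\<And>y. y \<in> U \<Longrightarrow> g differentiable (at y)"
    and "gradient g differentiable (at x)"
  shows "(hessian g x *v u) \<bullet> v = u \<bullet> (hessian g x *v v)"
proof -
  have "((\<lambda>t. (g (x + t *\<^sub>R u + t *\<^sub>R v) - g (x + t *\<^sub>R u) - g (x + t *\<^sub>R v) + g x) / t\<^sup>2)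
           \<longlongrightarrow> (hessian g x *v v) \<bullet> u) (at_right 0)"
    using second_difference_tendsto[OF assms, of v u] by (simp add: algebra_simps)
  with second_difference_tendsto[OF assms, of u v]
  have "(hessian g x *v u) \<bullet> v = (hessian g x *v v) \<bullet> u"
    by (intro tendsto_unique) auto
  then show ?thesis by (simp add: inner_commute)
qed

section \<open>The largest eigenvalue of a symmetric matrix\<close>

text \<open>Eigenvectors for distinct eigenvalues are orthogonal, so picking one per eigenvalue
  gives an independent, hence finite, set. This makes the \<open>Max\<close> in
  \<open>lambda_max\<close> meaningful.\<close>

lemma finite_eigenvalues:
  fixes A :: "real^'n^'n"
  assumes sym: "\<And>u v. (A *v u) \<bullet> v = u \<bullet> (A *v v)"
  shows "finite {l. \<exists>v. v \<noteq> 0 \<and> A *v v = l *\<^sub>R v}" (is "finite ?S")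
proof -
  define e where "e l = (SOME v. v \<noteq> 0 \<and> A *v v = l *\<^sub>R v)" for l
  have e: "e l \<noteq> 0 \<and> A *v e l = l *\<^sub>R e l" if "l \<in> ?S" for l
    using that unfolding e_def mem_Collect_eq by (rule someI_ex)
  have orth: "e l \<bullet> e m = 0" if "l \<in> ?S" "m \<in> ?S" "l \<noteq> m" for l m
  proof -
    have "l * (e l \<bullet> e m) = m * (e l \<bullet> e m)"
      using sym[of "e l" "e m"] e[OF that(1)] e[OF that(2)] by simp
    then show ?thesis using that by simp
  qed
  have inj: "inj_on e ?S"
  proof (rule inj_onI, rule ccontr)
    fix l m assume "l \<in> ?S" "m \<in> ?S" "e l = e m" "l \<noteq> m"
    then have "e l \<bullet> e l = 0" using orth[of l m] by simp
    then show False using e[OF \<open>l \<in> ?S\<close>] by simp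
  qed
  have "pairwise orthogonal (e ` ?S)"
    unfolding pairwise_def orthogonal_def using orth by blast
  moreover have "0 \<notin> e ` ?S" using e by force
  ultimately have "independent (e ` ?S)"
    by (rule pairwise_orthogonal_independent)
  then have "finite (e ` ?S)" by (rule independent_imp_finite)
  with inj show ?thesis by (rule finite_imageD[rotated])
qed

text \<open>A step \<open>t\<close> from \<open>v\<close> against \<open>w = B *v v\<close> changes
  the quadratic form to first order by \<open>- 2 * t * (w \<bullet> w)\<close>. Starting from 0 it
  would become negative unless \<open>w = 0\<close>.\<close>

lemma psd_null_vector:
  fixes B :: "real^'n^'n"
  assumes sym: "\<And>u v. (B *v u) \<bullet> v = u \<bullet> (B *v v)"
    and psd: "\<And>u. u \<bullet> (B *v u) \<ge> 0" and "v \<bullet> (B *v v) = 0"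
  shows "B *v v = 0"
proof (rule ccontr)
  define w where "w = B *v v"
  assume "B *v v \<noteq> 0"
  then have "w \<bullet> w > 0" by (simp add: w_def)
  define b where "b = w \<bullet> (B *v w)"
  have "b \<ge> 0" by (simp add: b_def psd)
  \<comment> \<open>Small enough that \<open>t * b \<le> w \<bullet> w\<close>, so the linear term
    dominates the quadratic one; the 1 in the denominator covers \<open>b = 0\<close>.\<close>
  define t where "t = (w \<bullet> w) / (b + 1)"
  have "t > 0" using \<open>b \<ge> 0\<close> \<open>w \<bullet> w > 0\<close> by (simp add: t_def)
  have "0 \<le> (v - t *\<^sub>R w) \<bullet> (B *v (v - t *\<^sub>R w))" by (rule psd)
  also have "B *v (v - t *\<^sub>R w) = w - t *\<^sub>R (B *v w)"
    by (simp add: w_def matrix_vector_mult_diff_distrib matrix_vector_mult_scaleR)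
  also have "(v - t *\<^sub>R w) \<bullet> (w - t *\<^sub>R (B *v w)) = t * (t * b - 2 * (w \<bullet> w))"
    using assms(3) sym[of v w]
    by (simp add: w_def b_def inner_diff_left inner_diff_right algebra_simps)
  finally have "2 * (w \<bullet> w) \<le> t * b"
    using \<open>t > 0\<close> by (simp add: zero_le_mult_iff)
  also have "t * b \<le> w \<bullet> w"
    using \<open>b \<ge> 0\<close> by (simp add: t_def field_simps)
  finally show False using \<open>w \<bullet> w > 0\<close> by simp
qed

text \<open>
  If \<open>v\<close> maximizes the Rayleigh quotient, with value \<open>l\<close>, then \<open>l I - A\<close> is positive semidefinite
  and its quadratic form vanishes at \<open>v\<close>; hence \<open>v\<close> is an eigenvector for \<open>l\<close>.
\<close>

lemma lambda_max_props:
  fixes A :: "real^'n^'n"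
  assumes sym: "\<And>u v. (A *v u) \<bullet> v = u \<bullet> (A *v v)"
  shows lambda_max_eigenvector: "\<exists>v. norm v = 1 \<and> A *v v = lambda_max A *\<^sub>R v"
    and lambda_max_rayleigh: "u \<bullet> (A *v u) \<le> lambda_max A * (norm u)\<^sup>2"
proof -
  have "\<exists>v\<in>sphere 0 1. \<forall>u\<in>sphere 0 1. u \<bullet> (A *v u) \<le> v \<bullet> (A *v v)"
    by (rule continuous_attains_sup) (auto intro!: continuous_intros)
  then obtain v where v: "norm v = 1" and max: "\<And>u. norm u = 1 \<Longrightarrow> u \<bullet> (A *v u) \<le> v \<bullet> (A *v v)"
    by auto
  define l where "l = v \<bullet> (A *v v)"
  have ray: "u \<bullet> (A *v u) \<le> l * (norm u)\<^sup>2" for u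
  proof (cases "u = 0")
    case False
    have "(u /\<^sub>R norm u) \<bullet> (A *v (u /\<^sub>R norm u)) \<le> l"
      unfolding l_def using False by (intro max) simp
    then have "(u \<bullet> (A *v u)) / (norm u)\<^sup>2 \<le> l"
      by (simp add: matrix_vector_mult_scaleR power2_eq_square field_simps)
    then show ?thesis using False by (simp add: pos_divide_le_eq)
  qed auto
  define B where "B = l *\<^sub>R mat 1 - A"
  have B: "B *v u = l *\<^sub>R u - A *v u" for u
    by (simp add: B_def matrix_vector_mult_diff_rdistrib scaleR_matrix_vector_assoc[symmetric])
  have "B *v v = 0"
  proof (rule psd_null_vector)
    show "(B *v u) \<bullet> w = u \<bullet> (B *v w)" for u w
      by (simp add: B inner_diff_left inner_diff_right sym)
    show "0 \<le> u \<bullet> (B *v u)" for u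
      using ray[of u] by (simp add: B inner_diff_right power2_norm_eq_inner)
    show "v \<bullet> (B *v v) = 0"
      using v by (simp add: B inner_diff_right l_def flip: power2_norm_eq_inner)
  qed
  then have ev: "A *v v = l *\<^sub>R v" by (simp add: B)
  have "lambda_max A = l"
    unfolding lambda_max_def
  proof (rule Max_eqI)
    show "finite {l. \<exists>v. v \<noteq> 0 \<and> A *v v = l *\<^sub>R v}"
      by (rule finite_eigenvalues[OF sym])
    show "m \<le> l" if "m \<in> {l. \<exists>v. v \<noteq> 0 \<and> A *v v = l *\<^sub>R v}" for m
    proof -
      from that obtain w where "w \<noteq> 0" "A *v w = m *\<^sub>R w" by auto
      then show ?thesis
        using ray[of w] by (simp add: power2_norm_eq_inner)
    qed
    show "l \<in> {l. \<exists>v. v \<noteq> 0 \<and> A *v v = l *\<^sub>R v}"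
    proof -
      have "v \<noteq> 0" using v by auto
      with ev show ?thesis by blast
    qed
  qed
  then show "\<exists>v. norm v = 1 \<and> A *v v = lambda_max A *\<^sub>R v" "u \<bullet> (A *v u) \<le> lambda_max A * (norm u)\<^sup>2"
    using v ev ray by auto
qed

text \<open>The entry sum is continuous in the matrix, hence bounded over the Hessians on a compact
  set; this is what makes the supremum in \<open>L_X\<close> a genuine upper bound. A unit
  eigenvector bounds the eigenvalue by the operator norm.\<close>

lemma lambda_max_le_component_sum:
  fixes A :: "real^'n^'n"
  assumes sym: "\<And>u v. (A *v u) \<bullet> v = u \<bullet> (A *v v)"
  shows "lambda_max A \<le> (\<Sum>i\<in>UNIV. \<Sum>j\<in>UNIV. \<bar>A $ i $ j\<bar>)"
proof -
  obtain v where v: "norm v = 1" "A *v v = lambda_max A *\<^sub>R v"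
    using lambda_max_eigenvector[OF sym] by blast
  have "lambda_max A \<le> norm (A *v v)" using v by simp
  also have "\<dots> \<le> onorm ((*v) A) * norm v" by (rule onorm) simp
  also have "\<dots> \<le> (\<Sum>i\<in>UNIV. \<Sum>j\<in>UNIV. \<bar>A $ i $ j\<bar>)"
    using v onorm_le_matrix_component_sum[of A] by simp
  finally show ?thesis .
qed

text \<open>By \<open>psd_null_vector\<close> the quadratic form is strictly positive at
  \<open>w\<close>, and the Rayleigh bound passes this on to the eigenvalue.\<close>

lemma lambda_max_pos:
  fixes A :: "real^'n^'n"
  assumes sym: "\<And>u v. (A *v u) \<bullet> v = u \<bullet> (A *v v)"
    and psd: "\<And>u. u \<bullet> (A *v u) \<ge> 0" and "A *v w \<noteq> 0"
  shows "lambda_max A > 0"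
proof -
  have "0 < w \<bullet> (A *v w)"
    using psd_null_vector[OF sym psd, of w] psd[of w] assms(3) by fastforce
  also have "\<dots> \<le> lambda_max A * (norm w)\<^sup>2"
    by (rule lambda_max_rayleigh[OF sym])
  finally show ?thesis
    by (simp add: zero_less_mult_iff)
qed

section \<open>Orthogonal projection\<close>

text \<open>Two candidates differ by an element of \<open>V\<close> that is orthogonal to both
  residuals, hence to itself. This gives access to the definite description in
  \<open>orth_proj\<close>.\<close>

lemma orth_projI:
  assumes "subspace V" "p \<in> V" "\<And>w. w \<in> V \<Longrightarrow> (x - p) \<bullet> w = 0"
  shows "orth_proj V x = p"
  unfolding orth_proj_def
proof (rule the_equality)
  show "p \<in> V \<and> (\<forall>w\<in>V. orthogonal (x - p) w)"
    using assms by (auto simp: orthogonal_def)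
  fix q assume q: "q \<in> V \<and> (\<forall>w\<in>V. orthogonal (x - q) w)"
  then have "q - p \<in> V" using assms subspace_diff by blast
  then have "(x - p) \<bullet> (q - p) = 0" "(x - q) \<bullet> (q - p) = 0"
    using assms(3) q by (auto simp: orthogonal_def)
  then have "(q - p) \<bullet> (q - p) = 0" by (simp add: inner_diff_left)
  then show "q = p" by simp
qed

lemma
  assumes "subspace V"
  shows orth_proj_in: "orth_proj V x \<in> V"
    and orth_proj_orthogonal: "w \<in> V \<Longrightarrow> (x - orth_proj V x) \<bullet> w = 0"
proof -
  obtain y z where "y \<in> span V" "\<And>w. w \<in> span V \<Longrightarrow> orthogonal z w" "x = y + z"
    using orthogonal_subspace_decomp_exists[of V x] by blast
  then have y: "y \<in> V" "\<And>w. w \<in> V \<Longrightarrow> (x - y) \<bullet> w = 0"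
    using assms by (auto simp: span_eq_iff[THEN iffD2] orthogonal_def)
  then have "orth_proj V x = y" using assms by (blast intro: orth_projI)
  with y show "orth_proj V x \<in> V" "w \<in> V \<Longrightarrow> (x - orth_proj V x) \<bullet> w = 0" by auto
qed

lemma orth_proj_diff:
  assumes "subspace V"
  shows "orth_proj V (x - y) = orth_proj V x - orth_proj V y"
proof (rule orth_projI[OF assms])
  show "orth_proj V x - orth_proj V y \<in> V"
    by (simp add: assms subspace_diff orth_proj_in)
  fix w assume "w \<in> V"
  then have "(x - orth_proj V x) \<bullet> w = 0" "(y - orth_proj V y) \<bullet> w = 0"
    by (simp_all add: assms orth_proj_orthogonal)
  then show "(x - y - (orth_proj V x - orth_proj V y)) \<bullet> w = 0"
    by (simp add: inner_diff_left)
qed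

lemma norm_orth_proj_le:
  assumes "subspace V"
  shows "norm (orth_proj V x) \<le> norm x"
proof (cases "orth_proj V x = 0")
  case False
  have "(x - orth_proj V x) \<bullet> orth_proj V x = 0"
    by (simp add: assms orth_proj_in orth_proj_orthogonal)
  then have "norm (orth_proj V x) * norm (orth_proj V x) = x \<bullet> orth_proj V x"
    by (simp add: inner_diff_left flip: power2_norm_eq_inner power2_eq_square)
  also have "\<dots> \<le> norm x * norm (orth_proj V x)" by (rule norm_cauchy_schwarz)
  finally show ?thesis using False by simp
qed simp

lemma bounded_orth_proj_image:
  assumes "subspace V" "bounded X"
  shows "bounded (orth_proj V ` X)"
proof -
  obtain B where "\<And>x. x \<in> X \<Longrightarrow> norm x \<le> B" using assms(2) bounded_iff by blast
  then show ?thesis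
    unfolding bounded_iff by (metis assms(1) imageE norm_orth_proj_le order_trans)
qed

section \<open>Volume bound for packings in a subspace\<close>

text \<open>
  Thickening a ball of a coordinate subspace to a cylinder makes the \<open>n\<close>-dimensional Lebesgue
  measure scale like the \<open>card I\<close>-dimensional volume.
\<close>

lemma measure_coordinate_cylinder:
  fixes p :: "real^'n" and I :: "'n set"
  assumes "s > 0" and p: "\<And>i. i \<notin> I \<Longrightarrow> p $ i = 0"
  defines "Q \<equiv> \<lambda>z::real^'n. \<chi> i. if i \<in> I then z $ i else 0"
  defines "C \<equiv> \<lambda>p s. {z. norm (Q z - p) < s \<and> norm (z - Q z) < 1}"
  shows "C p s \<in> lmeasurable" "measure lebesgue (C p s) = s ^ card I * measure lebesgue (C 0 1)"
    "measure lebesgue (C 0 1) > 0"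
proof -
  have linQ: "linear Q"
    by (rule linearI) (auto simp: Q_def vec_eq_iff)
  have contQ: "continuous_on UNIV Q"
    by (simp add: linQ linear_continuous_on linear_conv_bounded_linear[symmetric])
  have "open (C 0 1)"
    unfolding C_def Collect_conj_eq
    by (intro open_Int open_Collect_less continuous_intros contQ)
  moreover have "bounded (C 0 1)"
  proof -
    have "norm z \<le> 2" if "z \<in> C 0 1" for z
      using that norm_triangle_ineq[of "Q z" "z - Q z"] by (auto simp: C_def)
    then show ?thesis by (auto simp: bounded_iff)
  qed
  ultimately have C01: "C 0 1 \<in> lmeasurable" by (simp add: lmeasurable_open)
  \<comment> \<open>The general cylinder is the unit one stretched by \<open>s\<close> in the
    coordinates of \<open>I\<close> only and then translated by \<open>p\<close>. The translation
    leaves \<open>z - Q z\<close> alone because \<open>p\<close> vanishes outside \<open>I\<close>,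
    so the determinant \<open>s ^ card I\<close> is the volume ratio.\<close>
  define m where "m i = (if i \<in> I then s else 1)" for i
  let ?f = "\<lambda>x. \<chi> k. m k * x $ k :: real^'n"
  have C: "C p s = (+) p ` ?f ` C 0 1"
  proof -
    have "z \<in> C p s \<longleftrightarrow> (\<exists>w\<in>C 0 1. z = p + ?f w)" for z
    proof
      assume z: "z \<in> C p s"
      define w where "w = (\<chi> k. (z - p) $ k / m k)"
      have "Q w = (1 / s) *\<^sub>R (Q z - p)" "w - Q w = z - Q z"
        using p \<open>s > 0\<close> by (auto simp: Q_def w_def m_def vec_eq_iff)
      then have "w \<in> C 0 1"
        using z \<open>s > 0\<close> by (simp add: C_def)
      moreover have "z = p + ?f w"
        using \<open>s > 0\<close> by (simp add: w_def m_def vec_eq_iff)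
      ultimately show "\<exists>w\<in>C 0 1. z = p + ?f w" by blast
    next
      assume "\<exists>w\<in>C 0 1. z = p + ?f w"
      then obtain w where w: "w \<in> C 0 1" "z = p + ?f w" by blast
      then have "Q z - p = s *\<^sub>R Q w" "z - Q z = w - Q w"
        using p by (auto simp: Q_def m_def vec_eq_iff)
      then show "z \<in> C p s"
        using w \<open>s > 0\<close> by (simp add: C_def)
    qed
    then show ?thesis by auto
  qed
  show "C p s \<in> lmeasurable"
    unfolding C by (intro measurable_translation measurable_stretch C01)
  have "prod m UNIV = s ^ card I"
  proof -
    have "prod m UNIV = prod (\<lambda>i. s) I"
      unfolding m_def by (simp add: prod.If_cases)
    then show ?thesis by simp
  qed
  then show "measure lebesgue (C p s) = s ^ card I * measure lebesgue (C 0 1)"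
    unfolding C measure_translation using measure_stretch[OF C01, of m] \<open>s > 0\<close> by simp
  have "0 \<in> C 0 1" by (simp add: C_def linear_0[OF linQ])
  with \<open>open (C 0 1)\<close> have "\<not> negligible (C 0 1)"
    using open_not_negligible by blast
  then show "measure lebesgue (C 0 1) > 0"
    using C01 by (metis measure_nonneg negligible_iff_measure order_le_less)
qed

text \<open>The cylinders of radius \<open>r\<close> around the points of \<open>A\<close> are
  disjoint and lie in the cylinder of radius \<open>R + r\<close> around \<open>a\<close>. Comparing
  volumes, the measure of the unit cylinder cancels.\<close>

lemma card_separated_coordinate_subspace:
  fixes A :: "(real^'n) set" and I :: "'n set"
  assumes "finite A" "r > 0" "R \<ge> 0"
    and A: "\<And>x i. x \<in> A \<Longrightarrow> i \<notin> I \<Longrightarrow> x $ i = 0"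
    and sep: "\<And>x y. x \<in> A \<Longrightarrow> y \<in> A \<Longrightarrow> x \<noteq> y \<Longrightarrow> dist x y \<ge> 2 * r"
    and a: "a \<in> A" "\<And>x. x \<in> A \<Longrightarrow> dist a x \<le> R"
  shows "real (card A) * r ^ card I \<le> (R + r) ^ card I"
proof -
  define Q :: "real^'n \<Rightarrow> real^'n" where "Q z = (\<chi> i. if i \<in> I then z $ i else 0)" for z
  define C where "C p s = {z. norm (Q z - p) < s \<and> norm (z - Q z) < 1}" for p s
  note cyl = measure_coordinate_cylinder[where I=I, folded Q_def, folded C_def]
  have meas: "C x s \<in> lmeasurable" and
    vol: "measure lebesgue (C x s) = s ^ card I * measure lebesgue (C 0 1)" if "x \<in> A" "s > 0" for x s
    using cyl A that by blast+
  have "real (card A) * r ^ card I * measure lebesgue (C 0 1) = (\<Sum>x\<in>A. measure lebesgue (C x r))"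
    using vol assms by simp
  also have "\<dots> = measure lebesgue (\<Union>x\<in>A. C x r)"
  proof (rule measure_UNION'[symmetric])
    show "pairwise (\<lambda>x y. disjnt (C x r) (C y r)) A"
    proof (clarsimp simp: pairwise_def disjnt_iff)
      fix x y z assume xy: "x \<in> A" "y \<in> A" "x \<noteq> y" and z: "z \<in> C x r" "z \<in> C y r"
      have "dist x y \<le> norm (Q z - x) + norm (Q z - y)"
        by (metis dist_norm dist_triangle2 dist_commute)
      also have "\<dots> < 2 * r" using z by (simp add: C_def)
      finally show False using sep[OF xy] by simp
    qed
  qed (use assms meas in auto)
  also have "\<dots> \<le> measure lebesgue (C a (R + r))"
  proof (rule measure_mono_fmeasurable)
    show "(\<Union>x\<in>A. C x r) \<subseteq> C a (R + r)"
    proof (clarsimp simp: C_def)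
      fix x z assume "x \<in> A" "norm (Q z - x) < r"
      then show "norm (Q z - a) < R + r"
        using norm_triangle_ineq[of "Q z - x" "x - a"] a(2)[of x]
        by (simp add: dist_norm norm_minus_commute)
    qed
    show "(\<Union>x\<in>A. C x r) \<in> sets lebesgue"
      using assms meas by (intro sets.finite_UN fmeasurableD) auto
    show "C a (R + r) \<in> lmeasurable" using assms meas by simp
  qed
  also have "\<dots> = (R + r) ^ card I * measure lebesgue (C 0 1)"
    using assms by (intro vol) auto
  finally show ?thesis
    using cyl(3)[of 1 0] by simp
qed

text \<open>A linear isometry carries \<open>V\<close> onto a coordinate subspace of the same
  dimension, where the volume comparison applies with radii \<open>\<rho> / 2\<close> and
  \<open>D\<close>.\<close>

lemma card_separated_subspace:
  fixes A :: "(real^'n) set"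
  assumes "subspace V" "A \<subseteq> V" "finite A" "\<rho> > 0" "D \<ge> 0"
    and sep: "\<And>x y. x \<in> A \<Longrightarrow> y \<in> A \<Longrightarrow> x \<noteq> y \<Longrightarrow> dist x y > \<rho>"
    and diam: "\<And>x y. x \<in> A \<Longrightarrow> y \<in> A \<Longrightarrow> dist x y \<le> D"
  shows "real (card A) \<le> (1 + 2 * D / \<rho>) ^ dim V"
proof (cases "A = {}")
  case False
  then obtain a where "a \<in> A" by blast
  have "dim V \<le> CARD('n)" using dim_subset_UNIV[of V] by simp
  then obtain I :: "'n set" where I: "card I = dim V"
    by (metis obtain_subset_with_card_n)
  define W where "W = {x::real^'n. \<forall>i. i \<notin> I \<longrightarrow> x $ i = 0}"
  have "subspace W"
    by (auto simp: W_def subspace_def)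
  have dimW: "dim W = card I"
    unfolding W_def using dim_substandard_cart[where ?'a=real and d=I] by (simp add: dim_vec_eq)
  obtain f where f: "linear f" "f ` V = W" "\<And>x. x \<in> V \<Longrightarrow> norm (f x) = norm x"
    using isometry_subspaces[of V W] assms(1) \<open>subspace W\<close> dimW I by metis
  have df: "dist (f x) (f y) = dist x y" if "x \<in> A" "y \<in> A" for x y
    using f(3)[of "x - y"] that assms(1,2) subspace_diff[of V x y]
    by (simp add: dist_norm linear_diff[OF f(1)] subset_iff)
  have "inj_on f A"
    by (rule inj_onI) (metis df dist_eq_0_iff)
  have "real (card (f ` A)) * (\<rho> / 2) ^ card I \<le> (D + \<rho> / 2) ^ card I"
  proof (rule card_separated_coordinate_subspace)
    show "x $ i = 0" if "x \<in> f ` A" "i \<notin> I" for x i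
      using that f(2) assms(2) by (auto simp: W_def)
    show "f a \<in> f ` A" using \<open>a \<in> A\<close> by simp
    show "2 * (\<rho> / 2) \<le> dist x y" if "x \<in> f ` A" "y \<in> f ` A" "x \<noteq> y" for x y
    proof -
      from that(1,2) obtain x' y' where "x = f x'" "y = f y'" "x' \<in> A" "y' \<in> A" by blast
      moreover from this have "x' \<noteq> y'" using \<open>x \<noteq> y\<close> by blast
      ultimately show ?thesis using df[of x' y'] sep[of x' y'] by simp
    qed
    show "dist (f a) x \<le> D" if "x \<in> f ` A" for x
      using that df diam \<open>a \<in> A\<close> by auto
  qed (use assms in auto)
  then have "real (card A) \<le> (D + \<rho> / 2) ^ card I / (\<rho> / 2) ^ card I"
    using \<open>\<rho> > 0\<close> \<open>inj_on f A\<close> by (simp add: pos_le_divide_eq card_image)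
  also have "\<dots> = ((D + \<rho> / 2) / (\<rho> / 2)) ^ card I" by (rule power_divide[symmetric])
  also have "(D + \<rho> / 2) / (\<rho> / 2) = 1 + 2 * D / \<rho>"
    using \<open>\<rho> > 0\<close> by (simp add: field_simps)
  finally show ?thesis by (simp add: I)
qed (use assms in simp)

text \<open>The supremum is taken in \<open>enat\<close>, so the real bound is first rounded down to
  a natural number. Infinite packings, which count as infinity, are excluded because they contain
  finite packings of every size.\<close>

lemma packing_number_le:
  fixes S :: "(real^'n) set"
  assumes "subspace V" "S \<subseteq> V" "bounded S" "\<rho> > 0"
  shows "ereal_of_enat (packing_number S \<rho>) \<le> ereal ((1 + 2 * diameter S / \<rho>) ^ dim V)"
proof -
  define B where "B = (1 + 2 * diameter S / \<rho>) ^ dim V"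
  have D: "diameter S \<ge> 0" using assms(3) diameter_ge_0 by blast
  then have "B \<ge> 0" using assms by (simp add: B_def)
  have le: "card F \<le> nat \<lfloor>B\<rfloor>" if "F \<subseteq> S" "finite F" and "\<forall>x\<in>F. \<forall>y\<in>F. x \<noteq> y \<longrightarrow> dist x y > \<rho>" for F
  proof -
    have "real (card F) \<le> B"
      unfolding B_def
      by (rule card_separated_subspace[OF assms(1)])
        (use that assms D in \<open>auto intro!: diameter_bounded_bound[OF assms(3)]\<close>)
    then show ?thesis by (simp add: le_nat_floor)
  qed
  have "packing_number S \<rho> \<le> enat (nat \<lfloor>B\<rfloor>)"
    unfolding packing_number_def
  proof (rule SUP_least)
    fix A assume A: "A \<in> {A. A \<subseteq> S \<and> (\<forall>x\<in>A. \<forall>y\<in>A. x \<noteq> y \<longrightarrow> dist x y > \<rho>)}"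
    have "finite A"
    proof (rule ccontr)
      assume "infinite A"
      then obtain F where "F \<subseteq> A" "finite F" "card F = Suc (nat \<lfloor>B\<rfloor>)"
        by (metis infinite_arbitrarily_large)
      with le[of F] A show False by (auto simp: subset_iff)
    qed
    with le[of A] A show "(if finite A then enat (card A) else \<infinity>) \<le> enat (nat \<lfloor>B\<rfloor>)" by auto
  qed
  then have "ereal_of_enat (packing_number S \<rho>) \<le> ereal_of_enat (enat (nat \<lfloor>B\<rfloor>))"
    by (simp only: ereal_of_enat_le_iff)
  also have "\<dots> \<le> ereal B"
    using \<open>B \<ge> 0\<close> by simp
  finally show ?thesis by (simp add: B_def)
qed

section \<open>The adaptive lower-model method\<close>

lemma affine_minorant_le_lower_model:
  "i \<le> k \<Longrightarrow> affine_minorant g (x i) (v i) z \<le> lower_model g x v k z"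
proof (induction k)
  case (Suc k)
  then show ?case by (cases "i = Suc k") (auto simp: le_max_iff_disj)
qed simp

text \<open>Used when a run is extended: changing later choices must not disturb the models already
  built.\<close>

lemma lower_model_cong:
  assumes "\<And>i. i \<le> k \<Longrightarrow> x i = x' i" "\<And>i. i \<le> k \<Longrightarrow> v i = v' i"
  shows "lower_model g x v k = lower_model g x' v' k"
  using assms by (induction k) auto

lemma continuous_on_lower_model: "continuous_on S (lower_model g x v k)"
  by (induction k) (auto simp: affine_minorant_def[abs_def] intro!: continuous_intros)

text \<open>Convexity lives on \<open>C\<close> and smoothness on \<open>U\<close>, two
  neighbourhoods related only through the hull inside both; facts that combine the two are therefore
  stated at points of both sets.\<close>

locale lower_model_problem =
  fixes X C U :: "(real^'n) set" and g h :: "real^'n \<Rightarrow> real"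
  assumes nonempty: "X \<noteq> {}" and compact: "compact X"
    and C: "open C" "convex C" "convex hull X \<subseteq> C"
    and convex_g: "convex_on C g" and convex_h: "convex_on C h"
    and U: "open U" "convex hull X \<subseteq> U" and C2: "C2_on U g"
begin

lemma X_in_hull: "x \<in> X \<Longrightarrow> x \<in> convex hull X"
  by (rule hull_inc)

lemma hull_in_U: "z \<in> convex hull X \<Longrightarrow> z \<in> U" and hull_in_C: "z \<in> convex hull X \<Longrightarrow> z \<in> C"
  using C U by auto

section \<open>Gradients and Hessians of a smooth convex function\<close>

lemma differentiable: "z \<in> U \<Longrightarrow> g differentiable (at z)"
  and gradient_differentiable: "z \<in> U \<Longrightarrow> gradient g differentiable (at z)"
  using C2 by (auto simp: C2_on_def)

text \<open>By convexity the difference quotients from \<open>z\<close> towards \<open>y\<close> are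
  at most \<open>g y - g z\<close>, and their one-sided limit is the directional derivative.\<close>

lemma gradient_subgradient:
  assumes "z \<in> U" "z \<in> C" "y \<in> C"
  shows "g z + gradient g z \<bullet> (y - z) \<le> g y"
proof -
  let ?\<phi> = "\<lambda>t. g (z + t *\<^sub>R (y - z))"
  have "(?\<phi> has_real_derivative gradient g z \<bullet> (y - z)) (at 0)"
    using gradient_DERIV_segment[of g z 0 "y - z"] differentiable[OF assms(1)] by simp
  then have "((\<lambda>t. (?\<phi> t - ?\<phi> 0) / t) \<longlongrightarrow> gradient g z \<bullet> (y - z)) (at_right 0)"
    unfolding DERIV_def by (auto intro: tendsto_mono[OF at_le])
  moreover have "\<forall>\<^sub>F t in at_right 0. (?\<phi> t - ?\<phi> 0) / t \<le> g y - g z"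
    unfolding eventually_at_right_field
  proof (intro exI[of _ 1] conjI allI impI)
    fix t :: real assume t: "0 < t" "t < 1"
    have "g ((1 - t) *\<^sub>R z + t *\<^sub>R y) \<le> (1 - t) * g z + t * g y"
      using convex_g assms t by (intro convex_onD) auto
    moreover have "(1 - t) *\<^sub>R z + t *\<^sub>R y = z + t *\<^sub>R (y - z)" by (simp add: algebra_simps)
    ultimately have "?\<phi> t - ?\<phi> 0 \<le> (g y - g z) * t" by (simp add: algebra_simps)
    then show "(?\<phi> t - ?\<phi> 0) / t \<le> g y - g z" using t by (simp add: pos_divide_le_eq)
  qed simp
  ultimately have "gradient g z \<bullet> (y - z) \<le> g y - g z"
    by (intro tendsto_upperbound) auto
  then show ?thesis by simp
qed

text \<open>A subgradient \<open>v\<close> makes \<open>z\<close> a minimizer of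
  \<open>g y - v \<bullet> y\<close> over the open set \<open>C\<close>, so the derivative vanishes
  there. Hence the subgradients chosen by a run are forced, and Taylor estimates apply to its affine
  minorants.\<close>

lemma subdifferential_eq_gradient:
  assumes "z \<in> U" "z \<in> C"
  shows "subdifferential C g z = {gradient g z}"
proof
  show "{gradient g z} \<subseteq> subdifferential C g z"
    using gradient_subgradient[OF assms] by (simp add: subdifferential_def)
  show "subdifferential C g z \<subseteq> {gradient g z}"
  proof
    fix v assume v: "v \<in> subdifferential C g z"
    have "((\<lambda>y. g y - v \<bullet> y) has_derivative (\<lambda>h. gradient g z \<bullet> h - v \<bullet> h)) (at z)"
      by (intro derivative_intros gradient_has_derivative differentiable assms)
    moreover have "\<forall>y\<in>C. g z - v \<bullet> z \<le> g y - v \<bullet> y"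
      using v by (fastforce simp: subdifferential_def inner_diff_right)
    ultimately have "(\<lambda>h. gradient g z \<bullet> h - v \<bullet> h) = (\<lambda>h. 0)"
      using differential_zero_maxmin[of z C "\<lambda>y. g y - v \<bullet> y"] assms C(1) by blast
    then have "(gradient g z - v) \<bullet> (gradient g z - v) = 0"
      by (metis inner_diff_left)
    then show "v \<in> {gradient g z}" by simp
  qed
qed

lemma hessian_sym:
  "z \<in> U \<Longrightarrow> (hessian g z *v u) \<bullet> w = u \<bullet> (hessian g z *v w)"
  using hessian_symmetric[OF U(1)] differentiable gradient_differentiable by blast

lemma hessian_psd:
  assumes "z \<in> U" "z \<in> C"
  shows "u \<bullet> (hessian g z *v u) \<ge> 0"
proof (rule ccontr)
  let ?\<psi> = "\<lambda>t. gradient g (z + t *\<^sub>R u) \<bullet> u"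
  assume "\<not> ?thesis"
  then have neg: "(hessian g z *v u) \<bullet> u < 0" by (simp add: inner_commute)
  have "(?\<psi> has_real_derivative (hessian g z *v u) \<bullet> u) (at 0)"
    using hessian_DERIV_segment[of g z 0 u u] gradient_differentiable[OF assms(1)] by simp
  from DERIV_neg_dec_right[OF this neg] obtain d where
    d: "d > 0" "\<And>t. 0 < t \<Longrightarrow> t < d \<Longrightarrow> ?\<psi> t < ?\<psi> 0" by auto
  obtain e where e: "e > 0" "ball z e \<subseteq> U \<inter> C"
    using assms U(1) C(1) by (meson IntI openE open_Int)
  have "norm u + 1 > 0" by (simp add: add_nonneg_pos)
  then have "0 < min d (e / (norm u + 1))" using d(1) e(1) by simp
  then obtain t where t: "0 < t" "t < d" "t < e / (norm u + 1)"
    using dense[of 0 "min d (e / (norm u + 1))"] by auto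
  have "t * norm u < e"
  proof -
    have "t * (norm u + 1) < e" using t \<open>norm u + 1 > 0\<close> by (simp add: pos_less_divide_eq)
    then show ?thesis using t by (simp add: algebra_simps)
  qed
  then have "z + t *\<^sub>R u \<in> ball z e" using t by (simp add: dist_norm)
  then have y: "z + t *\<^sub>R u \<in> U" "z + t *\<^sub>R u \<in> C" using e by auto
  \<comment> \<open>Adding the two subgradient inequalities between \<open>z\<close> and
    \<open>z + t *\<^sub>R u\<close> shows that the gradient is monotone along \<open>u\<close>,
    against the decrease forced by a negative second derivative.\<close>
  have "t * ?\<psi> 0 \<le> t * ?\<psi> t"
    using gradient_subgradient[OF assms y(2)] gradient_subgradient[OF y assms(2)] by simp
  then show False using d(2)[of t] t by simp
qed

section \<open>Curvature bounds over the convex hull\<close>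

lemma bdd_above_lambda_max: "bdd_above ((\<lambda>z. lambda_max (hessian g z)) ` (convex hull X))"
proof -
  let ?s = "\<lambda>z. \<Sum>i\<in>UNIV. \<Sum>j\<in>UNIV. \<bar>hessian g z $ i $ j\<bar>"
  have "continuous_on (convex hull X) (hessian g)"
    using C2 U continuous_on_subset by (auto simp: C2_on_def)
  then have "continuous_on (convex hull X) ?s"
    by (intro continuous_intros)
  then have "bdd_above (?s ` (convex hull X))"
    by (intro bounded_imp_bdd_above compact_imp_bounded compact_continuous_image
        compact_convex_hull compact)
  then obtain B where "\<And>z. z \<in> convex hull X \<Longrightarrow> ?s z \<le> B"
    by (auto simp: bdd_above_def)
  then show ?thesis
    using lambda_max_le_component_sum[OF hessian_sym] hull_in_U
    by (intro bdd_aboveI2[of _ _ B]) (meson order_trans)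
qed

lemma lambda_max_le_L_X: "z \<in> convex hull X \<Longrightarrow> lambda_max (hessian g z) \<le> L_X X g"
  unfolding L_X_def by (rule cSUP_upper[OF _ bdd_above_lambda_max])

lemma subspace_V_X: "subspace (V_X X g)"
  by (simp add: V_X_def)

lemma hessian_in_V_X: "z \<in> convex hull X \<Longrightarrow> hessian g z *v u \<in> V_X X g"
  unfolding V_X_def by (intro span_base) blast

lemma hessian_quadratic_form_le:
  assumes "z \<in> convex hull X"
  shows "u \<bullet> (hessian g z *v u) \<le> L_X X g * (norm (orth_proj (V_X X g) u))\<^sup>2"
proof -
  define p where "p = orth_proj (V_X X g) u"
  note sym = hessian_sym[OF hull_in_U[OF assms]]
  \<comment> \<open>The residual \<open>u - p\<close> is orthogonal to the range of the Hessian;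
    together with symmetry this lets \<open>p\<close> replace \<open>u\<close> in both arguments of
    the form.\<close>
  have orth: "(u - p) \<bullet> (hessian g z *v w) = 0" for w
    unfolding p_def using subspace_V_X hessian_in_V_X[OF assms] by (rule orth_proj_orthogonal)
  have "u \<bullet> (hessian g z *v u) = p \<bullet> (hessian g z *v u)"
    using orth[of u] by (simp add: inner_diff_left)
  also have "\<dots> = u \<bullet> (hessian g z *v p)"
    using sym[of p u] by (simp add: inner_commute)
  also have "\<dots> = p \<bullet> (hessian g z *v p)"
    using orth[of p] by (simp add: inner_diff_left)
  also have "\<dots> \<le> lambda_max (hessian g z) * (norm p)\<^sup>2"
    by (rule lambda_max_rayleigh[OF sym])
  also have "\<dots> \<le> L_X X g * (norm p)\<^sup>2"
    by (intro mult_right_mono lambda_max_le_L_X assms) simp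
  finally show ?thesis by (simp add: p_def)
qed

lemma linearization_error_le:
  assumes "x \<in> convex hull X" "y \<in> convex hull X"
  shows "g y - affine_minorant g x (gradient g x) y \<le>
    L_X X g / 2 * (norm (orth_proj (V_X X g) (y - x)))\<^sup>2"
proof -
  define c where "c t = x + t *\<^sub>R (y - x)" for t
  have c: "c t \<in> convex hull X" if "0 \<le> t" "t \<le> 1" for t
  proof -
    have "c t = (1 - t) *\<^sub>R x + t *\<^sub>R y" by (simp add: c_def algebra_simps)
    then show ?thesis
      using convexD_alt[OF convex_convex_hull assms that] by simp
  qed
  \<comment> \<open>For \<open>m \<le> 2\<close> this is the \<open>m\<close>-th derivative of
    \<open>g\<close> along the segment, in the shape expected by \<open>Maclaurin\<close>; convexity
    of the hull keeps the segment where the Hessian bound holds.\<close>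
  define D where "D m t = (if m = 0 then g (c t) else if m = 1 then gradient g (c t) \<bullet> (y - x)
      else (hessian g (c t) *v (y - x)) \<bullet> (y - x))" for m :: nat and t
  have "\<exists>t. 0 < t \<and> t < 1 \<and>
      g (c 1) = (\<Sum>m<2. D m 0 / fact m * 1 ^ m) + D 2 t / fact 2 * 1 ^ 2"
  proof (rule Maclaurin)
    show "\<forall>m t. m < 2 \<and> 0 \<le> t \<and> t \<le> 1 \<longrightarrow> (D m has_real_derivative D (Suc m) t) (at t)"
    proof (intro allI impI)
      fix m :: nat and t :: real assume m: "m < 2 \<and> 0 \<le> t \<and> t \<le> 1"
      then have "c t \<in> U" using c hull_in_U by blast
      then have "((\<lambda>t. g (c t)) has_real_derivative gradient g (c t) \<bullet> (y - x)) (at t)"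
        "((\<lambda>t. gradient g (c t) \<bullet> (y - x)) has_real_derivative
          (hessian g (c t) *v (y - x)) \<bullet> (y - x)) (at t)"
        unfolding c_def
        by (auto intro!: gradient_DERIV_segment hessian_DERIV_segment differentiable gradient_differentiable)
      moreover have "m = 0 \<or> m = 1" using m by auto
      ultimately show "(D m has_real_derivative D (Suc m) t) (at t)"
        by (auto simp: D_def[abs_def])
    qed
  qed (auto simp: D_def)
  then obtain t where t: "0 < t" "t < 1"
      "g (c 1) = (\<Sum>m<2. D m 0 / fact m * 1 ^ m) + D 2 t / fact 2 * 1 ^ 2" by blast
  have "(hessian g (c t) *v (y - x)) \<bullet> (y - x) \<le> L_X X g * (norm (orth_proj (V_X X g) (y - x)))\<^sup>2"
    using hessian_quadratic_form_le[OF c[of t], of "y - x"] t by (simp add: inner_commute)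
  then show ?thesis
    using t(3) by (simp add: numeral_2_eq_2 D_def c_def affine_minorant_def)
qed

text \<open>A nontrivial \<open>V_X X g\<close> comes from a Hessian that is nonzero on some vector,
  and a nonzero positive semidefinite matrix has a positive eigenvalue. The packing radius is thus
  well defined.\<close>

lemma L_X_pos:
  assumes "d_X X g > 0"
  shows "L_X X g > 0"
proof -
  have "d_X X g \<noteq> 0" using assms by simp
  then have "\<not> V_X X g \<subseteq> {0}" by (simp add: d_X_def)
  then have "\<not> (\<Union>z\<in>convex hull X. range (\<lambda>u. hessian g z *v u)) \<subseteq> {0}"
    unfolding V_X_def using span_minimal[OF _ subspace_single_0] by blast
  then obtain z u where z: "z \<in> convex hull X" "hessian g z *v u \<noteq> 0"
    by blast
  then have "z \<in> U" "z \<in> C" using hull_in_U hull_in_C by auto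
  with z have "0 < lambda_max (hessian g z)"
    by (intro lambda_max_pos hessian_sym hessian_psd) auto
  also have "\<dots> \<le> L_X X g" using z by (simp add: lambda_max_le_L_X)
  finally show ?thesis .
qed

section \<open>Runs: separation of the iterates and continuation\<close>

lemma partial_run_in_X: "partial_run X C g h \<epsilon> x v K \<Longrightarrow> k \<le> K \<Longrightarrow> x k \<in> X"
  by (cases "k = 0") (auto simp: partial_run_def is_arg_min_def)

text \<open>Since \<open>k < K\<close>, the test has already failed at \<open>x k\<close>. The model
  tested there contains the minorant of every \<open>i \<le> k - 1\<close>, so each of these misses
  \<open>g\<close> by more than \<open>\<epsilon>\<close>, while Taylor bounds the miss from
  above.\<close>

lemma partial_run_gap:
  assumes run: "partial_run X C g h \<epsilon> x v K" and "i < k" "k < K"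
  shows "\<epsilon> < L_X X g / 2 * (dist (orth_proj (V_X X g) (x k)) (orth_proj (V_X X g) (x i)))\<^sup>2"
proof -
  have X: "x i \<in> convex hull X" "x k \<in> convex hull X"
    using partial_run_in_X[OF run] X_in_hull assms by auto
  have "v i \<in> subdifferential C g (x i)"
    using assms by (cases "i = 0") (auto simp: partial_run_def)
  then have v: "v i = gradient g (x i)"
    using subdifferential_eq_gradient X hull_in_U hull_in_C by blast
  have "\<epsilon> < g (x k) - lower_model g x v (k - 1) (x k)"
  proof -
    have "k \<in> {1..<K}" using assms(2,3) by simp
    then show ?thesis using run by (simp add: partial_run_def stops_at_def not_le)
  qed
  also have "\<dots> \<le> g (x k) - affine_minorant g (x i) (v i) (x k)"
    using affine_minorant_le_lower_model[of i "k - 1" g x v "x k"] assms by simp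
  also have "\<dots> \<le> L_X X g / 2 * (norm (orth_proj (V_X X g) (x k - x i)))\<^sup>2"
    unfolding v using X by (rule linearization_error_le)
  finally show ?thesis
    by (simp add: orth_proj_diff[OF subspace_V_X] dist_norm)
qed

text \<open>Projections onto the zero subspace vanish, so the gap inequality for the indices 0 and 1
  would read \<open>\<epsilon> < 0\<close>.\<close>

lemma partial_run_le_1:
  assumes "d_X X g = 0" "\<epsilon> > 0" "partial_run X C g h \<epsilon> x v K"
  shows "K \<le> 1"
proof (rule ccontr)
  assume "\<not> K \<le> 1"
  have "V_X X g \<subseteq> {0}" using assms(1) by (simp add: d_X_def)
  then have "orth_proj (V_X X g) z = 0" for z
    using orth_proj_in[OF subspace_V_X] by blast
  then show False
    using partial_run_gap[OF assms(3), of 0 1] \<open>\<not> K \<le> 1\<close> \<open>\<epsilon> > 0\<close> by simp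
qed

text \<open>The packing consists of the projections of \<open>x 0\<close> to
  \<open>x (K - 1)\<close>. The starting point is not a solved subproblem, and \<open>x K\<close> is
  left out because its test is still to be made; the two shifts cancel and leave exactly
  \<open>K\<close> points.\<close>

lemma partial_run_le_packing_number:
  assumes "d_X X g > 0" "\<epsilon> > 0" and run: "partial_run X C g h \<epsilon> x v K"
  shows "enat K \<le> packing_number (orth_proj (V_X X g) ` X) (sqrt (2 * \<epsilon> / L_X X g))"
proof -
  define \<rho> where "\<rho> = sqrt (2 * \<epsilon> / L_X X g)"
  define p where "p i = orth_proj (V_X X g) (x i)" for i
  have L: "L_X X g > 0" using assms(1) by (rule L_X_pos)
  have sep1: "\<rho> < dist (p k) (p i)" if "i < k" "k < K" for i k
  proof -
    have "2 * \<epsilon> / L_X X g < (dist (p k) (p i))\<^sup>2"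
      using partial_run_gap[OF run that] L by (simp add: p_def field_simps)
    then show ?thesis
      unfolding \<rho>_def by (intro real_less_lsqrt) auto
  qed
  have sep: "\<rho> < dist (p k) (p i)" if "i < K" "k < K" "i \<noteq> k" for i k
    using sep1[of i k] sep1[of k i] that by (metis dist_commute linorder_neqE_nat)
  have "\<rho> > 0" using L \<open>\<epsilon> > 0\<close> by (simp add: \<rho>_def)
  have "inj_on p {..<K}"
    using sep \<open>\<rho> > 0\<close> by (force intro: inj_onI)
  then have "enat K = (if finite (p ` {..<K}) then enat (card (p ` {..<K})) else \<infinity>)"
    by (simp add: card_image)
  also have "\<dots> \<le> packing_number (orth_proj (V_X X g) ` X) \<rho>"
    unfolding packing_number_def
  proof (rule SUP_upper)
    have "p ` {..<K} \<subseteq> orth_proj (V_X X g) ` X"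
      using partial_run_in_X[OF run] by (auto simp: p_def)
    then show "p ` {..<K} \<in> {A. A \<subseteq> orth_proj (V_X X g) ` X \<and>
        (\<forall>x\<in>A. \<forall>y\<in>A. x \<noteq> y \<longrightarrow> \<rho> < dist x y)}"
      using sep by auto
  qed
  finally show ?thesis by (simp add: \<rho>_def)
qed

text \<open>A convex function on an open set is continuous, so the objective attains its minimum on
  the compact set \<open>X\<close>.\<close>

lemma subproblem_solvable: "\<exists>y. is_arg_min (\<lambda>z. lower_model g x v k z - h z) (\<lambda>z. z \<in> X) y"
proof -
  have "continuous_on X h"
    using convex_on_continuous[OF C(1) convex_h] C(3) hull_subset[of X convex]
    by (meson continuous_on_subset order_trans)
  then have "continuous_on X (\<lambda>z. lower_model g x v k z - h z)"
    by (intro continuous_intros continuous_on_lower_model)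
  from continuous_attains_inf[OF compact nonempty this] show ?thesis
    by (auto simp: is_arg_min_linorder)
qed

text \<open>While the test fails or has not been made, one more subproblem can be solved. The bound
  \<open>N\<close> on all partial runs makes \<open>N - K\<close> a decreasing measure.\<close>

lemma partial_run_extends:
  assumes "\<And>x v K. partial_run X C g h \<epsilon> x v K \<Longrightarrow> K \<le> N"
    and "partial_run X C g h \<epsilon> x v K"
  shows "\<exists>x' v' K'. K \<le> K' \<and> (\<forall>i\<le>K. x' i = x i) \<and> (\<forall>i\<le>K - 1. v' i = v i) \<and>
           terminating_run X C g h \<epsilon> x' v' K'"
  using assms(2)
proof (induction "N - K" arbitrary: x v K rule: less_induct)
  case less
  note run = \<open>partial_run X C g h \<epsilon> x v K\<close>
  show ?case
  proof (cases "K \<ge> 1 \<and> stops_at g \<epsilon> x v K")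
    case True
    with run show ?thesis by (auto simp: terminating_run_def)
  next
    case False
    \<comment> \<open>For \<open>K = 0\<close> the run has already fixed \<open>v 0\<close>,
      consistently with \<open>K - 1 = 0\<close> in the conclusion. Otherwise the subgradient at
      \<open>x K\<close> is still open, and the gradient is a legal choice.\<close>
    define v' where "v' = (if K = 0 then v else v(K := gradient g (x K)))"
    obtain y where y: "is_arg_min (\<lambda>z. lower_model g x v' K z - h z) (\<lambda>z. z \<in> X) y"
      using subproblem_solvable by blast
    define x' where "x' = x(Suc K := y)"
    have x': "x' i = x i" if "i \<le> K" for i using that by (simp add: x'_def)
    have v': "v' i = v i" if "i \<le> K - 1" for i
      using that by (cases "K = 0") (auto simp: v'_def)
    have modelK: "lower_model g x' v' K = lower_model g x v' K"
      by (rule lower_model_cong) (auto simp: x')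
    have model: "lower_model g x' v' (k - 1) = lower_model g x v (k - 1)" if "k \<le> K" for k
      using that by (intro lower_model_cong x' v') auto
    have stops: "stops_at g \<epsilon> x' v' k \<longleftrightarrow> stops_at g \<epsilon> x v k" if "k \<le> K" for k
      using that by (simp only: stops_at_def model x')
    have "x K \<in> convex hull X" using partial_run_in_X[OF run] X_in_hull by blast
    then have vK: "v' K \<in> subdifferential C g (x K)" if "K \<noteq> 0"
      using that by (simp add: v'_def subdifferential_eq_gradient hull_in_U hull_in_C)
    have run': "partial_run X C g h \<epsilon> x' v' (Suc K)"
      unfolding partial_run_def
    proof (intro conjI ballI)
      show "x' 0 \<in> X" "v' 0 \<in> subdifferential C g (x' 0)"
        using run v'[of 0] by (auto simp: partial_run_def x')
      show "is_arg_min (\<lambda>z. lower_model g x' v' (k - 1) z - h z) (\<lambda>z. z \<in> X) (x' k)"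
        if "k \<in> {1..Suc K}" for k
      proof (cases "k = Suc K")
        case True
        then show ?thesis using y by (simp add: modelK) (simp add: x'_def)
      next
        case False
        with that have k: "k \<in> {1..K}" "k \<le> K" by auto
        with run show ?thesis unfolding partial_run_def model[OF k(2)] x'[OF k(2)] by blast
      qed
      show "\<not> stops_at g \<epsilon> x' v' k" if "k \<in> {1..<Suc K}" for k
        using that run False stops[of k] by (cases "k = K") (auto simp: partial_run_def)
      show "v' k \<in> subdifferential C g (x' k)" if "k \<in> {1..<Suc K}" for k
        using that run vK v'[of k] x'[of k] by (cases "k = K") (auto simp: partial_run_def)
    qed
    \<comment> \<open>The extended run is itself a partial run, so \<open>Suc K \<le> N\<close>;
      truncated subtraction therefore really decreases.\<close>
    then have "N - Suc K < N - K" using assms(1) by (meson Suc_le_eq diff_less_mono2 lessI)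
    from less(1)[OF this run'] obtain x'' v'' K' where
      "Suc K \<le> K'" "\<forall>i\<le>Suc K. x'' i = x' i" "\<forall>i\<le>K. v'' i = v' i"
      "terminating_run X C g h \<epsilon> x'' v'' K'" by auto
    with x' v' show ?thesis
      by (intro exI[of _ x''] exI[of _ v''] exI[of _ K']) auto
  qed
qed

lemma terminates_withinI:
  assumes "\<And>x v K. partial_run X C g h \<epsilon> x v K \<Longrightarrow> enat K \<le> N" "N < \<infinity>"
  shows "terminates_within X C g h \<epsilon> N"
proof -
  obtain n where "N = enat n" using assms(2) by (cases N) auto
  then show ?thesis
    unfolding terminates_within_def using assms(1) partial_run_extends[of \<epsilon> n] by simp
qed

section \<open>Explicit and asymptotic iteration bounds\<close>

lemma packing_number_bound:
  assumes "d_X X g > 0" "\<epsilon> > 0"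
  shows "ereal_of_enat (packing_number (orth_proj (V_X X g) ` X) (sqrt (2 * \<epsilon> / L_X X g)))
    \<le> ereal ((1 + D_X X g * sqrt (2 * L_X X g / \<epsilon>)) ^ d_X X g)"
proof -
  have L: "L_X X g > 0" using assms(1) by (rule L_X_pos)
  \<comment> \<open>The factor 2 of the volume bound enters the root as 4, which turns the quotient
    of diameter and packing radius into the stated product.\<close>
  have "2 / sqrt (2 * \<epsilon> / L_X X g) = sqrt (4 / (2 * \<epsilon> / L_X X g))"
    by (simp only: real_sqrt_divide real_sqrt_four)
  also have "\<dots> = sqrt (2 * L_X X g / \<epsilon>)"
    using L assms(2) by (simp add: field_simps)
  finally have *: "2 * D_X X g / sqrt (2 * \<epsilon> / L_X X g) = D_X X g * sqrt (2 * L_X X g / \<epsilon>)"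
    by (metis mult.commute times_divide_eq_right)
  show ?thesis
    unfolding *[symmetric] unfolding D_X_def d_X_def
  proof (rule packing_number_le[OF subspace_V_X])
    show "orth_proj (V_X X g) ` X \<subseteq> V_X X g"
      using orth_proj_in[OF subspace_V_X] by blast
    show "bounded (orth_proj (V_X X g) ` X)"
      by (intro bounded_orth_proj_image subspace_V_X compact_imp_bounded compact)
    show "0 < sqrt (2 * \<epsilon> / L_X X g)" using L assms(2) by simp
  qed
qed

text \<open>Unites both cases: for dimension 0 the power is 1, which matches the single subproblem
  solved there.\<close>

lemma partial_run_le_real:
  assumes "\<epsilon> > 0" "partial_run X C g h \<epsilon> x v K"
  shows "real K \<le> (1 + D_X X g * sqrt (2 * L_X X g / \<epsilon>)) ^ d_X X g"
proof (cases "d_X X g = 0")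
  case True
  then show ?thesis using partial_run_le_1[OF True assms] by simp
next
  case False
  then have d: "d_X X g > 0" by simp
  have "ereal_of_enat (enat K) \<le> ereal ((1 + D_X X g * sqrt (2 * L_X X g / \<epsilon>)) ^ d_X X g)"
    using partial_run_le_packing_number[OF d assms] packing_number_bound[OF d assms(1)]
    by (metis ereal_of_enat_le_iff order_trans)
  then show ?thesis by simp
qed

text \<open>The constant depends only on \<open>X\<close> and \<open>g\<close>, so the choices made
  by the runs may vary freely with \<open>\<epsilon>\<close>.\<close>

lemma outer_iterations_bigo:
  assumes "\<And>\<epsilon>. \<epsilon> > 0 \<Longrightarrow> \<exists>x v. terminating_run X C g h \<epsilon> x v (K \<epsilon>)"
  shows "(\<lambda>\<epsilon>. real (K \<epsilon>)) \<in> O[at_right 0](\<lambda>\<epsilon>. \<epsilon> powr (- real (d_X X g) / 2))"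
proof (rule bigoI)
  define c where "c = D_X X g * sqrt (2 * L_X X g)"
  have le: "real (K \<epsilon>) \<le> (1 + \<bar>c\<bar>) ^ d_X X g * \<epsilon> powr (- real (d_X X g) / 2)"
    if \<epsilon>: "0 < \<epsilon>" "\<epsilon> < 1" for \<epsilon>
  proof -
    obtain x v where "partial_run X C g h \<epsilon> x v (K \<epsilon>)"
      using assms[OF \<epsilon>(1)] by (auto simp: terminating_run_def)
    from partial_run_le_real[OF \<epsilon>(1) this]
    have "real (K \<epsilon>) \<le> (1 + c / sqrt \<epsilon>) ^ d_X X g"
      by (simp add: c_def real_sqrt_divide)
    \<comment> \<open>Absolute values avoid a discussion of the sign of \<open>c\<close>, and
      \<open>power_mono\<close> needs a nonnegative base.\<close>
    also have "\<dots> \<le> \<bar>1 + c / sqrt \<epsilon>\<bar> ^ d_X X g"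
      by (metis abs_ge_self power_abs)
    also have "\<dots> \<le> ((1 + \<bar>c\<bar>) / sqrt \<epsilon>) ^ d_X X g"
    proof (rule power_mono)
      have "\<bar>1 + c / sqrt \<epsilon>\<bar> \<le> 1 + \<bar>c\<bar> / sqrt \<epsilon>"
        using abs_triangle_ineq[of 1 "c / sqrt \<epsilon>"] \<epsilon> by simp
      \<comment> \<open>Here \<open>\<epsilon> < 1\<close> absorbs the constant term, so that a pure
        power of \<open>\<epsilon>\<close> remains.\<close>
      also have "1 \<le> 1 / sqrt \<epsilon>" using \<epsilon> by simp
      finally show "\<bar>1 + c / sqrt \<epsilon>\<bar> \<le> (1 + \<bar>c\<bar>) / sqrt \<epsilon>"
        by (simp add: add_divide_distrib)
    qed simp
    also have "\<dots> = (1 + \<bar>c\<bar>) ^ d_X X g * (1 / sqrt \<epsilon>) ^ d_X X g"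
      by (simp add: power_divide)
    also have "1 / sqrt \<epsilon> = \<epsilon> powr (- (1 / 2))"
      using \<epsilon> by (simp add: powr_minus_divide powr_half_sqrt)
    also have "\<dots> ^ d_X X g = \<epsilon> powr (- real (d_X X g) / 2)"
      using \<epsilon> by (simp add: powr_powr flip: powr_realpow)
    finally show ?thesis .
  qed
  show "\<forall>\<^sub>F \<epsilon> in at_right 0. norm (real (K \<epsilon>)) \<le>
      (1 + \<bar>c\<bar>) ^ d_X X g * norm (\<epsilon> powr (- real (d_X X g) / 2))"
    unfolding eventually_at_right_field using le by (intro exI[of _ 1]) simp
qed

end

theorem theorem7p2:
  fixes X C U :: "(real^'n) set" and g h :: "real^'n \<Rightarrow> real"
  assumes "X \<noteq> {}" and "compact X"
    and "open C" and "convex C" and "convex hull X \<subseteq> C"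
    and "convex_on C g" and "convex_on C h"
    and "open U" and "convex hull X \<subseteq> U" and "C2_on U g"
  shows "(\<forall>\<epsilon>>0.
      (d_X X g = 0 \<longrightarrow> terminates_within X C g h \<epsilon> 1) \<and>
      (d_X X g > 0 \<longrightarrow>
        (let N = packing_number (orth_proj (V_X X g) ` X) (sqrt (2 * \<epsilon> / L_X X g)) in
          terminates_within X C g h \<epsilon> N \<and>
          ereal_of_enat N \<le> ereal ((1 + D_X X g * sqrt (2 * L_X X g / \<epsilon>)) ^ d_X X g)))) \<and>
    (\<forall>K :: real \<Rightarrow> nat.
      (\<forall>\<epsilon>>0. \<exists>x v. terminating_run X C g h \<epsilon> x v (K \<epsilon>)) \<longrightarrow>
      (\<lambda>\<epsilon>. real (K \<epsilon>)) \<in> O[at_right 0](\<lambda>\<epsilon>. \<epsilon> powr (- real (d_X X g) / 2)))"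
proof -
  interpret lower_model_problem X C U g h
    using assms by unfold_locales
  have "terminates_within X C g h \<epsilon> 1" if "\<epsilon> > 0" "d_X X g = 0" for \<epsilon>
    using partial_run_le_1[OF that(2,1)] by (intro terminates_withinI) (auto simp: one_enat_def)
  moreover have "terminates_within X C g h \<epsilon> (packing_number (orth_proj (V_X X g) ` X) (sqrt (2 * \<epsilon> / L_X X g)))"
    if "\<epsilon> > 0" "d_X X g > 0" for \<epsilon>
  proof (rule terminates_withinI)
    show "packing_number (orth_proj (V_X X g) ` X) (sqrt (2 * \<epsilon> / L_X X g)) < \<infinity>"
      using packing_number_bound[OF that(2,1)] by (cases "packing_number (orth_proj (V_X X g) ` X) (sqrt (2 * \<epsilon> / L_X X g))") auto
  qed (rule partial_run_le_packing_number[OF that(2,1)])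
  ultimately show ?thesis
    using packing_number_bound outer_iterations_bigo by (simp add: Let_def)
qed

end
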